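(* The path Turán number $p(4)$ satisfies \[ p(4) \geq \frac{1}{4}\left(1 - \frac{1}{4}\right) + \frac{1}{584064}. \]
   Context: All infinite graphs here are simple graphs $G$ with vertex set $V(G) = \mathbb{N} = \{1,2,3,\dots\}$. For an integer $k \ge 1$, an increasing path of length $k$ in $G$, denoted $I_k$, is a sequence of $k+1$ vertices $i_1 < i_2 < \dots < i_{k+1}$ such that $i_j$ is adjacent to $i_{j+1}$ for $1 \leq j \leq k$. The graph $G$ is $I_k$-free if it contains no increasing path of length $k$. Let $G_n$ be the subgraph of $G$ induced by $\{1,2,\dots,n\}$, let $e(G_n)$ be its number of edges, and let $p(G) = \liminf_{n \to \infty} \frac{e(G_n)}{n^2}$. For $k \ge 2$, the path Turán number of $I_k$ is $p(k) = \sup\{ p(G) : G \text{ is } I_k\text{-free}\}$. *)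

theory Defs
  imports Complex_Main "HOL-Library.Extended_Real"
begin

(* A simple graph on the vertex set {1, 2, 3, ...} is given by its set of edges,
   each edge being a two-element set of positive integers. *)
definition nat_graph :: "nat set set \<Rightarrow> bool" where
  "nat_graph G \<longleftrightarrow> G \<subseteq> {{u, v} | u v. 1 \<le> u \<and> 1 \<le> v \<and> u \<noteq> v}"

definition increasing_path :: "nat set set \<Rightarrow> nat \<Rightarrow> (nat \<Rightarrow> nat) \<Rightarrow> bool" where
  "increasing_path G k i \<longleftrightarrow>
     (\<forall>j\<in>{1..k+1}. 1 \<le> i j) \<and>
     (\<forall>j\<in>{1..k}. i j < i (j + 1) \<and> {i j, i (j + 1)} \<in> G)"

definition increasing_path_free :: "nat \<Rightarrow> nat set set \<Rightarrow> bool" where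
  "increasing_path_free k G \<longleftrightarrow> (\<nexists>i. increasing_path G k i)"

definition initial_subgraph :: "nat set set \<Rightarrow> nat \<Rightarrow> nat set set" where
  "initial_subgraph G n = {e \<in> G. e \<subseteq> {1..n}}"

(* The lower limit and the supremum below are taken in the extended reals, where they
   always exist; for graphs on {1, 2, 3, ...} the ratios lie in the interval [0, 1/2]. *)
definition lower_density :: "nat set set \<Rightarrow> ereal" where
  "lower_density G = liminf (\<lambda>n. ereal (real (card (initial_subgraph G n)) / (real n)\<^sup>2))"

definition path_turan_number :: "nat \<Rightarrow> ereal" where
  "path_turan_number k = Sup {lower_density G | G. nat_graph G \<and> increasing_path_free k G}"

end

theory Submission
  imports Defs
begin

text \<open>
  Colour the vertices with $0,1,2,3$ and join $u < v$ whenever the colour of $u$ is smaller than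
  that of $v$. Colours increase strictly along an increasing path, so none has length 4. It remains
  to find a colouring with many ascents, that is, edges, in \<^emph>\<open>every\<close> initial segment.

  Among the first $n$ vertices let $\beta$ be the vector of the excesses of the four colour counts
  over $n/4$. The ascents number half of the pairs with distinct colours plus half of the difference
  between ascents and descents. The first half is $3n^2/16 - |\beta|^2/4$. In the second, the
  contribution that is linear in $\beta$ vanishes whenever the average colour is $3/2$, and what is
  left is a signed area swept out by $\beta$. Balanced periodic colourings keep $\beta$ bounded and give
  density $3/16$. The four words $0222$, $0033$, $1113$, $1122$ all have average colour $3/2$, and
  using them in this cyclic order, each for a fixed proportion of the time so far, sends $\beta$
  round a planar loop in the favourable direction. The area gained outweighs $|\beta|^2/4$. A loop
  of fixed size would be negligible against $n^2$, so each loop is three times as large as the one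
  before (\<open>word_scale\<close>); this keeps the gain at a constant fraction of $n^2$ forever.

  Concretely, with blocks of four vertices and $M = 3^m$, the words occupy the blocks from $6M$ to
  $8M$, $12M$, $16M$ and $18M$ respectively. A run of one word makes the colour counts linear and
  the number of ascents quadratic (\<open>state_run\<close>), so the counts follow by induction on $m$
  (\<open>state_period_start\<close>). The resulting density $433/2304 = 3/16 + 1/2304$
  (\<open>ascents_colour_ge\<close>) leaves a large margin over the required $3/16 + 1/584064$, which
  absorbs all lower-order terms.
\<close>

section \<open>Graphs of strictly increasing colour\<close>

definition ascent_graph :: "(nat \<Rightarrow> nat) \<Rightarrow> nat set set" where
  "ascent_graph c = {{u, v} | u v. 1 \<le> u \<and> u < v \<and> c u < c v}"

definition below :: "(nat \<Rightarrow> nat) \<Rightarrow> nat \<Rightarrow> nat \<Rightarrow> nat" where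
  "below c j n = card {u \<in> {1..n}. c u < j}"

definition ascents :: "(nat \<Rightarrow> nat) \<Rightarrow> nat \<Rightarrow> nat" where
  "ascents c n = card (initial_subgraph (ascent_graph c) n)"

lemma nat_graph_ascent_graph: "nat_graph (ascent_graph c)"
  unfolding nat_graph_def ascent_graph_def by fastforce

lemma ascent_graph_edge_less:
  assumes "{u, v} \<in> ascent_graph c" "u < v"
  shows "c u < c v"
  using assms by (auto simp: ascent_graph_def doubleton_eq_iff)

lemma ascent_graph_path_free:
  assumes "\<And>v. c v < k"
  shows "increasing_path_free k (ascent_graph c)"
  unfolding increasing_path_free_def
proof
  assume "\<exists>i. increasing_path (ascent_graph c) k i"
  then obtain i where i: "increasing_path (ascent_graph c) k i" by blast
  have "j \<le> k \<Longrightarrow> j \<le> c (i (j + 1))" for j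
  proof (induction j)
    case (Suc j)
    then have "c (i (Suc j)) < c (i (Suc j + 1))"
      using i ascent_graph_edge_less unfolding increasing_path_def by auto
    then show ?case using Suc by simp
  qed simp
  then have "k \<le> c (i (k + 1))" by simp
  then show False using assms[of "i (k + 1)"] by simp
qed

lemma below_Suc: "below c j (Suc n) = below c j n + (if c (Suc n) < j then 1 else 0)"
proof -
  have "{u \<in> {1..Suc n}. c u < j} =
      (if c (Suc n) < j then insert (Suc n) {u \<in> {1..n}. c u < j} else {u \<in> {1..n}. c u < j})"
    by (auto simp: le_Suc_eq)
  then show ?thesis by (simp add: below_def)
qed

lemma below_mono: "m \<le> n \<Longrightarrow> below c j m \<le> below c j n"
  unfolding below_def by (rule card_mono) auto

lemma ascents_Suc: "ascents c (Suc n) = ascents c n + below c (c (Suc n)) n"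
proof -
  let ?I = "initial_subgraph (ascent_graph c)"
  let ?U = "{u \<in> {1..n}. c u < c (Suc n)}"
  let ?f = "\<lambda>u. {u, Suc n}"
  have "e \<in> ?I n \<union> ?f ` ?U" if "e \<in> ?I (Suc n)" for e
  proof -
    obtain u v where e: "e = {u, v}" "1 \<le> u" "u < v" "c u < c v" "v \<le> Suc n"
      using \<open>e \<in> ?I (Suc n)\<close> by (auto simp: initial_subgraph_def ascent_graph_def)
    then show ?thesis
      by (cases "v = Suc n") (auto simp: initial_subgraph_def ascent_graph_def)
  qed
  moreover have "?f ` ?U \<subseteq> ?I (Suc n)"
    by (force simp: initial_subgraph_def ascent_graph_def)
  moreover have "?I n \<subseteq> ?I (Suc n)"
    by (auto simp: initial_subgraph_def)
  ultimately have "?I (Suc n) = ?I n \<union> ?f ` ?U" by blast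
  moreover have "finite (?I n)"
    by (rule finite_subset[of _ "Pow {1..n}"]) (auto simp: initial_subgraph_def)
  moreover have "?I n \<inter> ?f ` ?U = {}"
    by (auto simp: initial_subgraph_def)
  moreover have "card (?f ` ?U) = card ?U"
    by (rule card_image) (auto simp: inj_on_def doubleton_eq_iff)
  ultimately show ?thesis
    unfolding ascents_def below_def by (simp add: card_Un_disjoint)
qed

lemma ascents_mono: "m \<le> n \<Longrightarrow> ascents c m \<le> ascents c n"
  by (rule lift_Suc_mono_le) (simp add: ascents_Suc)

section \<open>Runs of a repeated word\<close>

definition block :: "(nat \<Rightarrow> nat) \<Rightarrow> nat \<Rightarrow> nat list" where
  "block c b = map c [Suc (4*b), Suc (Suc (4*b)), Suc (Suc (Suc (4*b))), Suc (Suc (Suc (Suc (4*b))))]"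

lemma below_block:
  "below c j (4 * Suc b) = below c j (4*b) + length (filter (\<lambda>x. x < j) (block c b))"
proof -
  have "4 * Suc b = Suc (Suc (Suc (Suc (4*b))))" by simp
  then show ?thesis
    by (simp only: below_Suc block_def) simp
qed

text \<open>Edges inside the block are dropped here: over all blocks they only amount to $O(n)$.\<close>
lemma ascents_block:
  "ascents c (4 * Suc b) \<ge> ascents c (4*b) + (\<Sum>j\<leftarrow>block c b. below c j (4*b))"
proof -
  have *: "4 * Suc b = Suc (Suc (Suc (Suc (4*b))))" by simp
  have "below c j (4*b) \<le> below c j (Suc (4*b))" "below c j (4*b) \<le> below c j (Suc (Suc (4*b)))"
    "below c j (4*b) \<le> below c j (Suc (Suc (Suc (4*b))))" for j
    by (simp_all add: below_mono)
  then show ?thesis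
    by (simp only: * ascents_Suc block_def list.map sum_list.Cons sum_list.Nil)
      (simp only: add.assoc add_0_right add_le_mono le_refl)
qed

lemma below_run:
  assumes "\<And>b. b0 \<le> b \<Longrightarrow> b < b0 + t \<Longrightarrow> block c b = w"
  shows "below c j (4 * (b0 + t)) = below c j (4*b0) + t * length (filter (\<lambda>x. x < j) w)"
  using assms
proof (induction t)
  case (Suc t)
  then have "block c (b0 + t) = w" by simp
  then show ?case using Suc below_block[of c j "b0 + t"] by simp
qed simp

text \<open>Every new block sees the vertices before the run and the earlier blocks of the run. The latter
  make up an arithmetic progression, hence the term $t(t-1)/2$.\<close>
lemma ascents_run:
  fixes w :: "nat list"
  assumes "\<And>b. b0 \<le> b \<Longrightarrow> b < b0 + t \<Longrightarrow> block c b = w"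
  shows "real (ascents c (4 * (b0 + t))) \<ge> real (ascents c (4*b0))
     + real t * real (\<Sum>j\<leftarrow>w. below c j (4*b0))
     + real t * (real t - 1) / 2 * real (\<Sum>j\<leftarrow>w. length (filter (\<lambda>x. x < j) w))"
  using assms
proof (induction t)
  case (Suc t)
  let ?r = "\<lambda>j. length (filter (\<lambda>x. x < j) w)"
  have w: "block c (b0 + t) = w" using Suc.prems by simp
  have "(\<Sum>j\<leftarrow>w. below c j (4*(b0 + t))) = (\<Sum>j\<leftarrow>w. below c j (4*b0) + t * ?r j)"
    using below_run[of b0 t c w] Suc.prems by simp
  also have "\<dots> = (\<Sum>j\<leftarrow>w. below c j (4*b0)) + t * (\<Sum>j\<leftarrow>w. ?r j)"
    by (simp add: sum_list_addf sum_list_const_mult)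
  finally have "ascents c (4 * (b0 + Suc t)) \<ge> ascents c (4 * (b0 + t))
     + ((\<Sum>j\<leftarrow>w. below c j (4*b0)) + t * (\<Sum>j\<leftarrow>w. ?r j))"
    using ascents_block[of c "b0 + t"] w by simp
  then have "real (ascents c (4 * (b0 + Suc t))) \<ge> real (ascents c (4 * (b0 + t)))
     + (real (\<Sum>j\<leftarrow>w. below c j (4*b0)) + real t * real (\<Sum>j\<leftarrow>w. ?r j))"
    by (metis of_nat_add of_nat_mult of_nat_le_iff)
  moreover have "real (ascents c (4 * (b0 + t))) \<ge> real (ascents c (4*b0))
     + real t * real (\<Sum>j\<leftarrow>w. below c j (4*b0))
     + real t * (real t - 1) / 2 * real (\<Sum>j\<leftarrow>w. ?r j)"
    using Suc by simp
  ultimately show ?case by (simp add: field_simps)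
qed simp

section \<open>The colouring\<close>

text \<open>One loop, cut into six pieces of equal length, so that a single division finds the piece.\<close>
definition cycle :: "nat list list" where
  "cycle = [[0,2,2,2], [0,0,3,3], [0,0,3,3], [1,1,1,3], [1,1,1,3], [1,1,2,2]]"

text \<open>The recursion through \<open>b div 3\<close> is what copies the loop on $[6, 18)$ to all larger scales.
  The first six blocks run through the loop once: this gives exactly the colour counts that one
  loop, extended backwards to all smaller scales, would have produced before block 6.\<close>
fun word :: "nat \<Rightarrow> nat list" where
  "word b = (if b < 6 then cycle ! b
     else if b < 18 then cycle ! ((b - 6) div 2) else word (b div 3))"

declare word.simps[simp del]

definition colour :: "nat \<Rightarrow> nat" where
  "colour v = word ((v - 1) div 4) ! ((v - 1) mod 4)"

lemma word_in_cycle: "word b \<in> set cycle"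
proof (induction b rule: word.induct)
  case (1 b)
  then show ?case
    by (subst word.simps) (auto simp: cycle_def intro!: nth_mem simp del: set_simps)
qed

lemma colour_less: "colour v < 4"
proof -
  have "\<forall>w\<in>set cycle. \<forall>k<4. w ! k < 4"
    by (simp add: cycle_def All_less_Suc numeral_eq_Suc)
  then show ?thesis using word_in_cycle by (simp add: colour_def)
qed

lemma block_colour: "block colour b = word b"
proof -
  have "length (word b) = 4" using word_in_cycle[of b] by (auto simp: cycle_def)
  then obtain w0 w1 w2 w3 where w: "word b = [w0, w1, w2, w3]"
    by (auto simp: numeral_eq_Suc length_Suc_conv)
  have "Suc (4*b) div 4 = b" "Suc (Suc (4*b)) div 4 = b" "Suc (Suc (Suc (4*b))) div 4 = b"
     "Suc (4*b) mod 4 = 1" "Suc (Suc (4*b)) mod 4 = 2" "Suc (Suc (Suc (4*b))) mod 4 = 3"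
    by presburger+
  then show ?thesis
    by (simp add: block_def colour_def w)
qed

text \<open>All piece boundaries are integer multiples of $3^m$, so rounding in \<open>b div 3\<close> never moves a
  block across one.\<close>
lemma word_scale:
  assumes "k < 6" "(6 + 2*k) * 3^m \<le> b" "b < (8 + 2*k) * 3^m"
  shows "word b = cycle ! k"
  using assms(2,3)
proof (induction m arbitrary: b)
  case 0
  then have "6 \<le> b" "b < 18" "(b - 6) div 2 = k" using assms(1) by auto
  then show ?case by (subst word.simps) simp
next
  case (Suc m)
  have "(1::nat) \<le> 3^m" by simp
  then have "6 * 3 \<le> (6 + 2*k) * 3^Suc m" by (intro mult_mono) simp_all
  then have "18 \<le> b" using Suc.prems(1) by linarith
  moreover have "(6 + 2*k) * 3^m \<le> b div 3"
    using Suc.prems(1) by (simp add: less_eq_div_iff_mult_less_eq algebra_simps)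
  moreover have "b div 3 < (8 + 2*k) * 3^m"
    using Suc.prems(2) by (simp add: div_less_iff_less_mult algebra_simps)
  ultimately show ?case using Suc.IH by (subst word.simps) simp
qed

section \<open>Counting along one period\<close>

text \<open>The counts of the colours below 1, 2 and 3 are all that later ascents depend on. They are
  tracked exactly, the ascents only from below.\<close>
definition state :: "nat \<Rightarrow> real \<Rightarrow> real \<Rightarrow> real \<Rightarrow> real \<Rightarrow> bool" where
  "state b l1 l2 l3 e \<longleftrightarrow> real (below colour 1 (4*b)) = l1 \<and> real (below colour 2 (4*b)) = l2 \<and>
     real (below colour 3 (4*b)) = l3 \<and> e \<le> real (ascents colour (4*b))"

lemma state_weaken:
  assumes "state b l1 l2 l3 e" "l1 = l1'" "l2 = l2'" "l3 = l3'" "e' \<le> e"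
  shows "state b l1' l2' l3' e'"
  using assms by (simp add: state_def)

lemma below_0: "below c 0 n = 0"
  by (simp add: below_def)

lemma state_run:
  assumes "state b0 l1 l2 l3 e" and w: "\<And>b. b0 \<le> b \<Longrightarrow> b < b0 + t \<Longrightarrow> word b = w"
  shows "w = [0,2,2,2] \<Longrightarrow> state (b0 + t) (l1 + real t) (l2 + real t) (l3 + 4 * real t)
            (e + real t * (3*l2) + 3/2 * (real t * (real t - 1)))"
    and "w = [0,0,3,3] \<Longrightarrow> state (b0 + t) (l1 + 2 * real t) (l2 + 2 * real t) (l3 + 2 * real t)
            (e + real t * (2*l3) + 2 * (real t * (real t - 1)))"
    and "w = [1,1,1,3] \<Longrightarrow> state (b0 + t) l1 (l2 + 3 * real t) (l3 + 3 * real t)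
            (e + real t * (3*l1 + l3) + 3/2 * (real t * (real t - 1)))"
    and "w = [1,1,2,2] \<Longrightarrow> state (b0 + t) l1 (l2 + 2 * real t) (l3 + 4 * real t)
            (e + real t * (2*l1 + 2*l2) + 2 * (real t * (real t - 1)))"
proof -
  have b: "\<And>b. b0 \<le> b \<Longrightarrow> b < b0 + t \<Longrightarrow> block colour b = w"
    using w by (simp add: block_colour)
  note runs = below_run[of b0 t colour w 1, OF b] below_run[of b0 t colour w 2, OF b]
    below_run[of b0 t colour w 3, OF b] ascents_run[of b0 t colour w, OF b]
  show "state (b0 + t) (l1 + real t) (l2 + real t) (l3 + 4 * real t)
            (e + real t * (3*l2) + 3/2 * (real t * (real t - 1)))" if "w = [0,2,2,2]"
    using assms(1) runs that by (auto simp: state_def below_0 field_simps)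
  show "state (b0 + t) (l1 + 2 * real t) (l2 + 2 * real t) (l3 + 2 * real t)
            (e + real t * (2*l3) + 2 * (real t * (real t - 1)))" if "w = [0,0,3,3]"
    using assms(1) runs that by (auto simp: state_def below_0 field_simps)
  show "state (b0 + t) l1 (l2 + 3 * real t) (l3 + 3 * real t)
            (e + real t * (3*l1 + l3) + 3/2 * (real t * (real t - 1)))" if "w = [1,1,1,3]"
    using assms(1) runs that by (auto simp: state_def below_0 field_simps)
  show "state (b0 + t) l1 (l2 + 2 * real t) (l3 + 4 * real t)
            (e + real t * (2*l1 + 2*l2) + 2 * (real t * (real t - 1)))" if "w = [1,1,2,2]"
    using assms(1) runs that by (auto simp: state_def below_0 field_simps)
qed

text \<open>The counts $5M, 13M, 18M$ are self-similar: a full loop triples them. The leading coefficient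
  109 is forced in the same way. A loop adds $872 M^2$ ascents at leading order, and
  $\kappa + 872 = 9 \kappa$ gives $\kappa = 109$; the linear term $11M$ makes up for the $21M$ lost
  through the terms $t(t-1)$ on the way.\<close>
lemma period_runs:
  fixes M :: real and m :: nat
  defines "M \<equiv> 3^m"
  assumes "state (6 * 3^m) (5*M) (13*M) (18*M) (109*M^2 - 11*M)"
  shows "t \<le> 2 * 3^m \<Longrightarrow> state (6 * 3^m + t) (5*M + real t) (13*M + real t) (18*M + 4 * real t)
           (109*M^2 - 11*M + real t * (39*M) + 3/2 * (real t * (real t - 1)))"
    and "t \<le> 4 * 3^m \<Longrightarrow> state (8 * 3^m + t) (7*M + 2 * real t) (15*M + 2 * real t) (26*M + 2 * real t)
           (193*M^2 - 14*M + real t * (52*M) + 2 * (real t * (real t - 1)))"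
    and "t \<le> 4 * 3^m \<Longrightarrow> state (12 * 3^m + t) (15*M) (23*M + 3 * real t) (34*M + 3 * real t)
           (433*M^2 - 22*M + real t * (79*M) + 3/2 * (real t * (real t - 1)))"
    and "t \<le> 2 * 3^m \<Longrightarrow> state (16 * 3^m + t) (15*M) (35*M + 2 * real t) (46*M + 4 * real t)
           (773*M^2 - 28*M + real t * (100*M) + 2 * (real t * (real t - 1)))"
proof -
  have A: "word b = [0,2,2,2]" if "6 * 3^m \<le> b" "b < 8 * 3^m" for b
    using word_scale[of 0 m b] that by (simp add: cycle_def)
  have B: "word b = [0,0,3,3]" if "8 * 3^m \<le> b" "b < 12 * 3^m" for b
    using word_scale[of 1 m b] word_scale[of 2 m b] that by (fastforce simp: cycle_def)
  have C: "word b = [1,1,1,3]" if "12 * 3^m \<le> b" "b < 16 * 3^m" for b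
    using word_scale[of 3 m b] word_scale[of 4 m b] that by (fastforce simp: cycle_def)
  have D: "word b = [1,1,2,2]" if "16 * 3^m \<le> b" "b < 18 * 3^m" for b
    using word_scale[of 5 m b] that by (simp add: cycle_def)
  have M: "real (3^m) = M" by (simp add: M_def)
  show 1: "state (6 * 3^m + t) (5*M + real t) (13*M + real t) (18*M + 4 * real t)
      (109*M^2 - 11*M + real t * (39*M) + 3/2 * (real t * (real t - 1)))" if "t \<le> 2 * 3^m" for t
    using state_run(1)[OF assms(2) _ refl, of t] A that by simp
  have s2: "state (8 * 3^m) (7*M) (15*M) (26*M) (193*M^2 - 14*M)"
    using 1[of "2 * 3^m"] M by (auto elim!: state_weaken simp: field_simps power2_eq_square)
  show 2: "state (8 * 3^m + t) (7*M + 2 * real t) (15*M + 2 * real t) (26*M + 2 * real t)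
      (193*M^2 - 14*M + real t * (52*M) + 2 * (real t * (real t - 1)))" if "t \<le> 4 * 3^m" for t
    using state_run(2)[OF s2 _ refl, of t] B that by simp
  have s3: "state (12 * 3^m) (15*M) (23*M) (34*M) (433*M^2 - 22*M)"
    using 2[of "4 * 3^m"] M by (auto elim!: state_weaken simp: field_simps power2_eq_square)
  show 3: "state (12 * 3^m + t) (15*M) (23*M + 3 * real t) (34*M + 3 * real t)
      (433*M^2 - 22*M + real t * (79*M) + 3/2 * (real t * (real t - 1)))" if "t \<le> 4 * 3^m" for t
    using state_run(3)[OF s3 _ refl, of t] C that by simp
  have s4: "state (16 * 3^m) (15*M) (35*M) (46*M) (773*M^2 - 28*M)"
    using 3[of "4 * 3^m"] M by (auto elim!: state_weaken simp: field_simps power2_eq_square)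
  show "state (16 * 3^m + t) (15*M) (35*M + 2 * real t) (46*M + 4 * real t)
      (773*M^2 - 28*M + real t * (100*M) + 2 * (real t * (real t - 1)))" if "t \<le> 2 * 3^m" for t
    using state_run(4)[OF s4 _ refl, of t] D that by simp
qed

lemma state_period_start:
  "state (6 * 3^m) (5 * 3^m) (13 * 3^m) (18 * 3^m) (109 * (3^m)^2 - 11 * 3^m)"
proof (induction m)
  case 0
  have "state 0 0 0 0 0" by (simp add: state_def below_def)
  have w: "word 0 = [0,2,2,2]" "word 1 = [0,0,3,3]" "word 2 = [0,0,3,3]" "word 3 = [1,1,1,3]"
    "word 4 = [1,1,1,3]" "word 5 = [1,1,2,2]"
    by (subst word.simps, simp add: cycle_def)+
  have B: "word b = [0,0,3,3]" if "1 \<le> b" "b < 1 + 2" for b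
  proof -
    have "b = 1 \<or> b = 2" using that by linarith
    then show ?thesis using w by auto
  qed
  have C: "word b = [1,1,1,3]" if "3 \<le> b" "b < 3 + 2" for b
  proof -
    have "b = 3 \<or> b = 4" using that by linarith
    then show ?thesis using w by auto
  qed
  have "state 1 1 1 4 0"
    using state_run(1)[OF \<open>state 0 0 0 0 0\<close> _ refl, of 1] w by simp
  then have "state 3 5 5 8 20"
    using state_run(2)[of 1 1 1 4 0 2, OF _ B refl] by (simp add: numeral_3_eq_3)
  then have "state 5 5 11 14 69"
    using state_run(3)[of 3 5 5 8 20 2, OF _ C refl] by simp
  moreover have D: "word b = [1,1,2,2]" if "5 \<le> b" "b < 5 + 1" for b
  proof -
    have "b = 5" using that by linarith
    then show ?thesis using w by auto
  qed
  ultimately have "state 6 5 13 18 101"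
    using state_run(4)[of 5 5 11 14 69 1, OF _ D refl] by simp
  then show ?case by (auto elim!: state_weaken)
next
  case (Suc m)
  have "state (6 * 3^Suc m) (15 * 3^m) (35 * 3^m + 2 * real (2 * 3^m)) (46 * 3^m + 4 * real (2 * 3^m))
      (773 * (3^m)^2 - 28 * 3^m + real (2 * 3^m) * (100 * 3^m)
        + 2 * (real (2 * 3^m) * (real (2 * 3^m) - 1)))"
    using period_runs(4)[OF Suc, of "2 * 3^m"] by simp
  moreover have "(1::real) \<le> 3^m" by simp
  ultimately show ?case
    by (auto elim!: state_weaken simp: field_simps power2_eq_square)
qed

lemma period_exists:
  fixes b :: nat
  assumes "6 \<le> b"
  obtains m :: nat where "6 * 3^m \<le> b" "b < 18 * 3^m"
proof -
  have "\<exists>m::nat. 6 * 3^m \<le> b \<and> b < 18 * 3^m" using assms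
  proof (induction b rule: less_induct)
    case (less b)
    show ?case
    proof (cases "b < 18")
      case True
      then show ?thesis using less.prems by (intro exI[of _ 0]) simp
    next
      case False
      then have "b div 3 < b" "6 \<le> b div 3" by simp_all
      then obtain m where "6 * 3^m \<le> b div 3" "b div 3 < 18 * 3^m"
        using less.IH by blast
      then have "6 * 3^Suc m \<le> b" "b < 18 * 3^Suc m"
        by simp_all
      then show ?thesis by blast
    qed
  qed
  then show ?thesis using that by blast
qed

text \<open>At leading order the two sides agree at $b = 12M$, where $433M^2$ ascents are known: this is
  the scale at which the construction is worst. On each run the difference of the two sides is a
  concave quadratic in the length $t$ of the run so far, because $3/2$ and $2$ are less than
  $433/144$. Hence it suffices that it is nonnegative at both ends, and the linear inequalities
  between $t^2$, $Mt$ and $M^2$ that express $0 \le t \le \tau M$ certify this.\<close>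
lemma ascents_colour_ge:
  assumes "6 \<le> b"
  shows "real (ascents colour (4*b)) \<ge> 433/144 * (real b)^2 - 2 * real b"
proof -
  obtain m where m: "6 * 3^m \<le> b" "b < 18 * 3^m" using period_exists[OF assms] .
  define M :: real where "M = 3^m"
  have M: "real (3^m) = M" "M > 0" by (simp_all add: M_def)
  note runs = period_runs[OF state_period_start[of m], folded M_def]
  consider "b < 8 * 3^m" | "8 * 3^m \<le> b" "b < 12 * 3^m" | "12 * 3^m \<le> b" "b < 16 * 3^m"
    | "16 * 3^m \<le> b" by linarith
  then show ?thesis
  proof cases
    case 1
    then obtain t where t: "b = 6 * 3^m + t" "t \<le> 2 * 3^m" using m le_Suc_ex[of "6*3^m" b] by auto
    then have "real t \<le> 2*M" using M by (metis of_nat_le_iff of_nat_mult of_nat_numeral)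
    then have "real t * real t \<le> 2*M * real t" "M * t \<le> M * (2*M)" "0 \<le> M * t"
      using M by (auto intro!: mult_right_mono mult_left_mono)
    moreover have "real b = 6 * M + t" using t M by simp
    ultimately show ?thesis
      using runs(1)[OF t(2)] M unfolding t(1)[symmetric] state_def
      by (simp only: power2_eq_square algebra_simps) linarith
  next
    case 2
    then obtain t where t: "b = 8 * 3^m + t" "t \<le> 4 * 3^m" using le_Suc_ex[of "8*3^m" b] by auto
    then have "real t \<le> 4*M" using M by (metis of_nat_le_iff of_nat_mult of_nat_numeral)
    then have "real t * real t \<le> 4*M * real t" "M * t \<le> M * (4*M)" "0 \<le> M * t"
      using M by (auto intro!: mult_right_mono mult_left_mono)
    moreover have "real b = 8 * M + t" using t M by simp
    ultimately show ?thesis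
      using runs(2)[OF t(2)] M unfolding t(1)[symmetric] state_def
      by (simp only: power2_eq_square algebra_simps) linarith
  next
    case 3
    then obtain t where t: "b = 12 * 3^m + t" "t \<le> 4 * 3^m" using le_Suc_ex[of "12*3^m" b] by auto
    then have "real t \<le> 4*M" using M by (metis of_nat_le_iff of_nat_mult of_nat_numeral)
    then have "real t * real t \<le> 4*M * real t" "M * t \<le> M * (4*M)" "0 \<le> M * t"
      using M by (auto intro!: mult_right_mono mult_left_mono)
    moreover have "real b = 12 * M + t" using t M by simp
    ultimately show ?thesis
      using runs(3)[OF t(2)] M unfolding t(1)[symmetric] state_def
      by (simp only: power2_eq_square algebra_simps) linarith
  next
    case 4
    then obtain t where t: "b = 16 * 3^m + t" "t \<le> 2 * 3^m" using m le_Suc_ex[of "16*3^m" b] by auto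
    then have "real t \<le> 2*M" using M by (metis of_nat_le_iff of_nat_mult of_nat_numeral)
    then have "real t * real t \<le> 2*M * real t" "M * t \<le> M * (2*M)" "0 \<le> M * t"
      using M by (auto intro!: mult_right_mono mult_left_mono)
    moreover have "real b = 16 * M + t" using t M by simp
    ultimately show ?thesis
      using runs(4)[OF t(2)] M unfolding t(1)[symmetric] state_def
      by (simp only: power2_eq_square algebra_simps) linarith
  qed
qed

lemma lower_density_colour: "lower_density (ascent_graph colour) \<ge> ereal (3/16 + 1/584064)"
  unfolding lower_density_def
proof (rule Liminf_bounded, rule eventually_sequentiallyI)
  fix n :: nat
  \<comment> \<open>The threshold only has to make the quadratic margin exceed the linear error terms.\<close>
  assume n: "100000 \<le> n"
  define b where "b = n div 4"
  have b: "6 \<le> b" "4*b \<le> n" "n < 4*b + 4" using n by (auto simp: b_def)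
  have "(3/16 + 1/584064) * (4 * real b + 4)^2 \<le> 433/144 * (real b)^2 - 2 * real b"
  proof -
    define y where "y = (real b)^2"
    have "20000 * real b \<le> y"
      using n b unfolding y_def power2_eq_square by (intro mult_right_mono) auto
    moreover have "(4 * real b + 4)^2 = 16 * y + 32 * real b + 16"
      by (simp add: y_def power2_eq_square algebra_simps)
    moreover have "6 \<le> real b" using b by simp
    ultimately show ?thesis unfolding y_def[symmetric] by (simp add: field_simps)
  qed
  moreover have "(3/16 + 1/584064) * (real n)^2 \<le> (3/16 + 1/584064) * (4 * real b + 4)^2"
    using b by (intro mult_left_mono power_mono) auto
  moreover have "real (ascents colour (4*b)) \<le> real (ascents colour n)"
    using b ascents_mono by simp
  ultimately have "(3/16 + 1/584064) * (real n)^2 \<le> real (ascents colour n)"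
    using ascents_colour_ge[OF b(1)] by linarith
  then show "ereal (3/16 + 1/584064)
      \<le> ereal (real (card (initial_subgraph (ascent_graph colour) n)) / (real n)\<^sup>2)"
    using n by (simp add: ascents_def pos_le_divide_eq)
qed

theorem mainTheorem3:
  shows "path_turan_number 4 \<ge> ereal (1/4 * (1 - 1/4) + 1/584064)"
proof -
  have "lower_density (ascent_graph colour) \<le> path_turan_number 4"
    unfolding path_turan_number_def
    using nat_graph_ascent_graph ascent_graph_path_free[of colour 4] colour_less by (intro Sup_upper) blast
  then show ?thesis using lower_density_colour by (simp add: order_trans)
qed

end
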